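(* Let $k$ be an integer and let $\mathbf{y}$ be an aperiodic infinite binary word. Then the word $\mathbf{x}=\varphi^k(\mathbf{y})$, and any suffix of it, has property $\mathrm{TM}(k)$, i.e., for every $1\le j\le k$ its $j$-binomial complexity equals the $j$-binomial complexity of the Thue--Morse word $\mathbf{t}$.
   Context: $\varphi\colon\{0,1\}^*\to\{0,1\}^*$ is the Thue--Morse morphism $0\mapsto 01$, $1\mapsto 10$, and $\mathbf{t}=01101001\cdots$ is its fixed point starting with $0$. For words $u,w$, $\binom{u}{w}$ is the number of occurrences of $w$ as a scattered subword of $u$; $u\sim_j v$ if $\binom{u}{x}=\binom{v}{x}$ for all words $x$ of length at most $j$. The $j$-binomial complexity of an infinite word $\mathbf{x}$ is $b^{(j)}_{\mathbf{x}}(n)=\#(\mathrm{Fac}_n(\mathbf{x})/\sim_j)$, where $\mathrm{Fac}_n(\mathbf{x})$ is the set of length-$n$ factors. A binary word $\mathbf{x}$ has property $\mathrm{TM}(k)$ if $b^{(j)}_{\mathbf{x}}=b^{(j)}_{\mathbf{t}}$ for all $1\le j\le k$. An infinite word is aperiodic if it is not ultimately periodic. *)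

theory Defs
  imports Complex_Main "HOL-Library.Omega_Words_Fun"
begin

text \<open>Infinite words are functions on \<^typ>\<open>nat\<close>; the binary alphabet is \<^typ>\<open>bool\<close>,
  with \<^const>\<open>False\<close> for the letter 0 and \<^const>\<open>True\<close> for the letter 1.\<close>

definition subword_binom :: "'a list \<Rightarrow> 'a list \<Rightarrow> nat" where
  "subword_binom u w = card {I. I \<subseteq> {..<length u} \<and> nths u I = w}"

definition binom_equiv :: "nat \<Rightarrow> ('a list \<times> 'a list) set" where
  "binom_equiv j = {(u, v). \<forall>x. length x \<le> j \<longrightarrow> subword_binom u x = subword_binom v x}"

definition factors :: "nat \<Rightarrow> 'a word \<Rightarrow> 'a list set" where
  "factors n x = {subsequence x i (i + n) | i. True}"

definition binom_complexity :: "nat \<Rightarrow> 'a word \<Rightarrow> nat \<Rightarrow> nat" where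
  "binom_complexity j x n = card (factors n x // binom_equiv j)"

definition ultimately_periodic :: "'a word \<Rightarrow> bool" where
  "ultimately_periodic x \<longleftrightarrow> (\<exists>p>0. \<exists>N. \<forall>n\<ge>N. x (n + p) = x n)"

definition aperiodic :: "'a word \<Rightarrow> bool" where
  "aperiodic x \<longleftrightarrow> \<not> ultimately_periodic x"

fun tm_letter :: "bool \<Rightarrow> bool list" where
  "tm_letter False = [False, True]"
| "tm_letter True = [True, False]"

definition tm_morph :: "bool list \<Rightarrow> bool list" where
  "tm_morph w = concat (map tm_letter w)"

text \<open>Since the morphism does not erase letters, the image of the prefix of length
  \<open>n + 1\<close> of \<open>x\<close> has length greater than \<open>n\<close>, so it determines the letter at
  position \<open>n\<close> of the image of \<open>x\<close>.\<close>

definition tm_morph_inf :: "bool word \<Rightarrow> bool word" where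
  "tm_morph_inf x = (\<lambda>n. tm_morph (prefix (Suc n) x) ! n)"

definition thue_morse :: "bool word" where
  "thue_morse = (THE x. tm_morph_inf x = x \<and> x 0 = False)"

definition TM :: "nat \<Rightarrow> bool word \<Rightarrow> bool" where
  "TM k x \<longleftrightarrow> (\<forall>j. 1 \<le> j \<and> j \<le> k \<longrightarrow> binom_complexity j x = binom_complexity j thue_morse)"

lemma length_tm_letter [simp]: "length (tm_letter a) = 2"
  by (cases a) auto

lemma length_tm_morph [simp]: "length (tm_morph w) = 2 * length w"
  by (induction w) (auto simp: tm_morph_def)

lemma tm_morph_nth:
  "n < 2 * length w \<Longrightarrow> tm_morph w ! n = tm_letter (w ! (n div 2)) ! (n mod 2)"
proof (induction w arbitrary: n)
  case (Cons a w)
  show ?case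
  proof (cases "n < 2")
    case True
    then show ?thesis by (simp add: tm_morph_def nth_append)
  next
    case False
    then obtain m where m: "n = m + 2" by (metis add.commute le_Suc_ex not_less)
    then show ?thesis using Cons.IH[of m] Cons.prems
      by (simp add: tm_morph_def nth_append)
  qed
qed simp

lemma tm_morph_inf_nth: "tm_morph_inf x n = tm_letter (x (n div 2)) ! (n mod 2)"
  by (simp add: tm_morph_inf_def tm_morph_nth subsequence_def del: upt_Suc)

lemma tm_morph_inf_even [simp]: "tm_morph_inf x (2 * n) = x n"
  by (cases "x n") (simp_all add: tm_morph_inf_nth)

lemma tm_morph_inf_odd [simp]: "tm_morph_inf x (Suc (2 * n)) = (\<not> x n)"
  by (cases "x n") (simp_all add: tm_morph_inf_nth)

lemma prefix_tm_morph_inf: "prefix (2 * n) (tm_morph_inf x) = tm_morph (prefix n x)"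
  by (rule nth_equalityI)
    (auto simp: tm_morph_nth tm_morph_inf_nth subsequence_def less_mult_imp_div_less mult.commute)

fun tm_rec :: "nat \<Rightarrow> bool" where
  "tm_rec n = (if n = 0 then False else (tm_rec (n div 2) \<noteq> odd n))"

declare tm_rec.simps [simp del]

lemma tm_rec_fixed: "tm_morph_inf tm_rec = tm_rec"
proof
  fix n
  show "tm_morph_inf tm_rec n = tm_rec n"
  proof (cases "even n")
    case True
    then obtain m where m: "n = 2 * m" by blast
    then show ?thesis using tm_rec.simps[of n] tm_morph_inf_even[of tm_rec m] by (cases "m = 0") (simp_all del: tm_morph_inf_even)
  next
    case False
    then obtain m where m: "n = Suc (2 * m)" by (auto elim: oddE)
    then show ?thesis using tm_rec.simps[of n] by simp
  qed
qed

lemma ex1_thue_morse: "\<exists>!x. tm_morph_inf x = x \<and> x 0 = False"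
proof (rule ex1I)
  show "tm_morph_inf tm_rec = tm_rec \<and> tm_rec 0 = False"
    by (simp add: tm_rec_fixed tm_rec.simps[of 0])
next
  fix x assume x: "tm_morph_inf x = x \<and> x 0 = False"
  have "x n = tm_rec n" for n
  proof (induction n rule: less_induct)
    case (less n)
    show ?case
    proof (cases "n = 0")
      case True
      then show ?thesis using x tm_rec.simps[of 0] by simp
    next
      case False
      then have IH: "x (n div 2) = tm_rec (n div 2)" using less by simp
      have "x n = tm_letter (x (n div 2)) ! (n mod 2)"
        using x tm_morph_inf_nth[of x n] by simp
      also have "\<dots> = tm_letter (tm_rec (n div 2)) ! (n mod 2)" by (simp add: IH)
      also have "\<dots> = tm_rec n" by (metis tm_rec_fixed tm_morph_inf_nth)
      finally show ?thesis .
    qed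
  qed
  then show "x = tm_rec" by blast
qed

lemma thue_morse_fixed: "tm_morph_inf thue_morse = thue_morse"
  and thue_morse_0: "thue_morse 0 = False"
  using theI'[OF ex1_thue_morse] unfolding thue_morse_def by blast+

lemma equiv_binom_equiv: "equiv UNIV (binom_equiv j)"
  by (auto simp: equiv_def refl_on_def sym_def trans_def binom_equiv_def)

end

theory Submission
  imports Defs
begin

text \<open>
  Write \<open>\<phi>\<close> for the Thue--Morse morphism. If \<open>u\<close> and \<open>v\<close> are \<open>j\<close>-binomially equivalent, then
  \<open>uv\<close> and \<open>vu\<close> are \<open>(j+1)\<close>-binomially equivalent; hence the \<open>(j+1)\<close>-class of \<open>\<phi>\<^sup>j(w)\<close> depends only
  on the number of occurrences of each letter in \<open>w\<close>. A factor of \<open>\<phi>\<^sup>j(\<phi>(y))\<close> is cut by the block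
  boundaries into a suffix of \<open>\<phi>\<^sup>j(c)\<close>, a word \<open>\<phi>\<^sup>j(w)\<close> and a prefix of \<open>\<phi>\<^sup>j(d)\<close>, where \<open>cwd\<close> is a
  factor of \<open>\<phi>(y)\<close>, so its class depends only on the offset, \<open>c\<close>, \<open>d\<close> and the letter counts of \<open>w\<close>.
  The triples of \<open>c\<close>, \<open>d\<close> and the number of ones in \<open>w\<close> that occur in \<open>\<phi>(y)\<close> for a given length
  of \<open>w\<close> are the same for all aperiodic \<open>y\<close>, and each of them occurs infinitely often, because a
  binary word with \<open>y(n) \<le> y(n+p)\<close> for all large \<open>n\<close> is ultimately periodic. So any two words
  \<open>\<phi>\<^sup>j\<^sup>+\<^sup>1(y)\<close> with \<open>y\<close> aperiodic, one of them being the Thue--Morse word, have the same classes of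
  factors.
\<close>

subsection \<open>Binomial equivalence\<close>

lemma subword_binom_Nil_right [simp]: "subword_binom u [] = 1"
proof -
  have "{I. I \<subseteq> {..<length u} \<and> nths u I = []} = {{}}"
    by (auto simp flip: length_0_conv simp: length_nths)
  then show ?thesis by (simp add: subword_binom_def)
qed

lemma subword_binom_Nil_left: "subword_binom [] x = (if x = [] then 1 else 0)"
  by (auto simp: subword_binom_def)

text \<open>Pascal's rule: an occurrence either skips position 0, or uses it for \<open>b\<close>,
  which forces \<open>a = b\<close>.\<close>

lemma subword_binom_Cons_Cons:
  "subword_binom (a # u) (b # x) = subword_binom u (b # x) + (if a = b then subword_binom u x else 0)"
proof -
  define S where "S z = {I. I \<subseteq> {..<length u} \<and> nths u I = z}" for z
  have fin: "finite (S z)" for z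
    by (rule finite_subset[of _ "Pow {..<length u}"]) (auto simp: S_def)
  \<comment> \<open>Shifting back recovers \<open>J\<close> from either shape; this evaluates
    \<open>nths_Cons\<close> and shows both maps injective.\<close>
  have pre: "{j. Suc j \<in> Suc ` J} = J" "{j. Suc j \<in> insert 0 (Suc ` J)} = J" for J
    by auto
  have split: "(\<exists>J. J \<subseteq> {..<length u} \<and> (I = Suc ` J \<or> I = insert 0 (Suc ` J)))"
    if "I \<subseteq> {..<length (a # u)}" for I
  proof -
    define J where "J = {j. Suc j \<in> I}"
    have "J \<subseteq> {..<length u}" using that by (auto simp: J_def)
    moreover have "I = Suc ` J \<or> I = insert 0 (Suc ` J)"
    proof (cases "0 \<in> I")
      case True
      have "n \<in> insert 0 (Suc ` J)" if "n \<in> I" for n using that by (cases n) (auto simp: J_def)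
      with True show ?thesis by (auto simp: J_def)
    next
      case False
      have "n \<in> Suc ` J" if "n \<in> I" for n using that False by (cases n) (auto simp: J_def)
      then show ?thesis by (auto simp: J_def)
    qed
    ultimately show ?thesis by blast
  qed
  have "{I. I \<subseteq> {..<length (a # u)} \<and> nths (a # u) I = b # x} =
      (`) Suc ` S (b # x) \<union> (if a = b then (\<lambda>J. insert 0 (Suc ` J)) ` S x else {})"
    (is "?L = ?R")
  proof
    show "?L \<subseteq> ?R"
    proof
      fix I assume I: "I \<in> ?L"
      then obtain J where J: "J \<subseteq> {..<length u}" "I = Suc ` J \<or> I = insert 0 (Suc ` J)"
        using split[of I] by auto
      from J(2) show "I \<in> ?R"
      proof
        assume "I = Suc ` J"
        moreover from this have "J \<in> S (b # x)" using I J(1) by (simp add: S_def nths_Cons pre)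
        ultimately show ?thesis by blast
      next
        assume "I = insert 0 (Suc ` J)"
        moreover from this have "J \<in> S x" "a = b" using I J(1) by (simp_all add: S_def nths_Cons pre)
        ultimately show ?thesis by simp
      qed
    qed
    show "?R \<subseteq> ?L"
      by (auto simp: S_def nths_Cons pre split: if_splits)
  qed
  moreover have "card ((`) Suc ` S (b # x)) = card (S (b # x))"
    by (intro card_image inj_on_inverseI[where g = "\<lambda>I. {j. Suc j \<in> I}"]) (rule pre)
  moreover have "card ((\<lambda>J. insert 0 (Suc ` J)) ` S x) = card (S x)"
    by (intro card_image inj_on_inverseI[where g = "\<lambda>I. {j. Suc j \<in> I}"]) (rule pre)
  moreover have "(`) Suc ` S (b # x) \<inter> (\<lambda>J. insert 0 (Suc ` J)) ` S x = {}"
    by auto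
  ultimately show ?thesis
    by (auto simp: subword_binom_def card_Un_disjoint fin simp flip: S_def)
qed

text \<open>Vandermonde-type identity: each occurrence puts a prefix of \<open>x\<close> into
  \<open>u\<close> and the rest into \<open>v\<close>.\<close>

lemma subword_binom_append:
  "subword_binom (u @ v) x =
    (\<Sum>i\<le>length x. subword_binom u (take i x) * subword_binom v (drop i x))"
proof (induction u arbitrary: x)
  case Nil
  have "(\<Sum>i\<le>length x. subword_binom [] (take i x) * subword_binom v (drop i x)) =
      (\<Sum>i\<le>length x. if i = 0 then subword_binom v x else 0)"
    by (intro sum.cong) (auto simp: subword_binom_Nil_left)
  then show ?case by simp
next
  case (Cons c u)
  show ?case
  proof (cases x)
    case Nil
    then show ?thesis by simp
  next
    case x: (Cons b x')
    show ?thesis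
      by (simp add: x subword_binom_Cons_Cons Cons.IH sum.atMost_Suc_shift sum.distrib
          add_mult_distrib del: sum.atMost_Suc)
  qed
qed

lemma binom_equivD: "(u, v) \<in> binom_equiv j \<Longrightarrow> length x \<le> j \<Longrightarrow> subword_binom u x = subword_binom v x"
  by (simp add: binom_equiv_def)

lemma binom_equiv_refl [simp]: "(u, u) \<in> binom_equiv j"
  by (simp add: binom_equiv_def)

lemma binom_equiv_sym: "(u, v) \<in> binom_equiv j \<Longrightarrow> (v, u) \<in> binom_equiv j"
  by (simp add: binom_equiv_def)

lemma binom_equiv_trans:
  "(u, v) \<in> binom_equiv j \<Longrightarrow> (v, w) \<in> binom_equiv j \<Longrightarrow> (u, w) \<in> binom_equiv j"
  by (simp add: binom_equiv_def)

lemma binom_equiv_append: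
  assumes "(u, u') \<in> binom_equiv j" "(v, v') \<in> binom_equiv j"
  shows "(u @ v, u' @ v') \<in> binom_equiv j"
  unfolding binom_equiv_def
  by (auto simp: subword_binom_append intro!: sum.cong arg_cong2[where f = "(*)"]
      binom_equivD[OF assms(1)] binom_equivD[OF assms(2)])

text \<open>For \<open>x\<close> of length \<open>j + 1\<close>, only the two extreme splittings of \<open>x\<close> involve the whole of \<open>x\<close>,
  and these two are exchanged.\<close>

lemma binom_equiv_append_commute:
  assumes "(u, v) \<in> binom_equiv j"
  shows "(u @ v, v @ u) \<in> binom_equiv (Suc j)"
proof -
  have "subword_binom (u @ v) x = subword_binom (v @ u) x" if len: "length x \<le> Suc j" for x
  proof (cases "length x")
    case 0
    then show ?thesis by simp
  next
    case (Suc n)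
    have split: "(\<Sum>i\<le>length x. f i) = f 0 + f (length x) + (\<Sum>i<n. f (Suc i))" for f :: "nat \<Rightarrow> nat"
      by (simp add: Suc sum.atMost_shift)
    have "(\<Sum>i<n. subword_binom u (take (Suc i) x) * subword_binom v (drop (Suc i) x)) =
        (\<Sum>i<n. subword_binom v (take (Suc i) x) * subword_binom u (drop (Suc i) x))"
      using len Suc
      by (intro sum.cong refl arg_cong2[where f = "(*)"] binom_equivD[OF assms]
          binom_equivD[OF binom_equiv_sym[OF assms]]) auto
    then show ?thesis
      unfolding subword_binom_append split by simp
  qed
  then show ?thesis by (simp add: binom_equiv_def)
qed

subsection \<open>Powers of the Thue--Morse morphism\<close>

lemma tm_morph_append: "tm_morph (u @ v) = tm_morph u @ tm_morph v"
  by (simp add: tm_morph_def)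

lemma funpow_tm_morph_append: "(tm_morph ^^ k) (u @ v) = (tm_morph ^^ k) u @ (tm_morph ^^ k) v"
  by (induction k) (simp_all add: tm_morph_append)

lemma funpow_tm_morph_Nil [simp]: "(tm_morph ^^ k) [] = []"
  by (induction k) (simp_all add: tm_morph_def)

lemma length_funpow_tm_morph [simp]: "length ((tm_morph ^^ k) w) = 2 ^ k * length w"
  by (induction k) simp_all

text \<open>The images of the two letters under one more power are \<open>A @ B\<close> and
  \<open>B @ A\<close>, with \<open>A\<close> and \<open>B\<close> equivalent by induction, so
  commuting gains one level.\<close>

lemma funpow_tm_morph_letter_equiv:
  "((tm_morph ^^ k) [a], (tm_morph ^^ k) [b]) \<in> binom_equiv k"
proof (induction k arbitrary: a b)
  case 0
  then show ?case by (simp add: binom_equiv_def)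
next
  case (Suc k)
  have "(tm_morph ^^ Suc k) [c] = (tm_morph ^^ k) [c] @ (tm_morph ^^ k) [\<not> c]" for c
    by (cases c) (simp_all add: funpow_Suc_right tm_morph_def flip: funpow_tm_morph_append del: funpow.simps)
  then show ?case
    using binom_equiv_append_commute[OF Suc.IH] by (cases a; cases b) auto
qed

text \<open>The block of \<open>a\<close> moves past \<open>u\<close> one block at a time; each
  exchange of neighbours is an instance of \<open>binom_equiv_append_commute\<close>.\<close>

lemma funpow_tm_morph_swap:
  "((tm_morph ^^ k) (a # u @ v), (tm_morph ^^ k) (u @ a # v)) \<in> binom_equiv (Suc k)"
proof (induction u)
  case (Cons b u)
  have "((tm_morph ^^ k) ([a] @ [b]) @ (tm_morph ^^ k) (u @ v),
      (tm_morph ^^ k) ([b] @ [a]) @ (tm_morph ^^ k) (u @ v)) \<in> binom_equiv (Suc k)"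
    unfolding funpow_tm_morph_append
    by (intro binom_equiv_append binom_equiv_append_commute funpow_tm_morph_letter_equiv
        binom_equiv_refl)
  moreover have "((tm_morph ^^ k) [b] @ (tm_morph ^^ k) (a # u @ v),
      (tm_morph ^^ k) [b] @ (tm_morph ^^ k) (u @ a # v)) \<in> binom_equiv (Suc k)"
    by (intro binom_equiv_append Cons.IH binom_equiv_refl)
  ultimately show ?case
    by (auto simp flip: funpow_tm_morph_append intro: binom_equiv_trans)
qed simp

text \<open>Sorting the blocks yields a normal form determined by length and number of ones.\<close>

lemma funpow_tm_morph_sort_equiv:
  "((tm_morph ^^ k) w,
    (tm_morph ^^ k) (replicate (count_list w True) True @ replicate (length w - count_list w True) False))
    \<in> binom_equiv (Suc k)"
proof (induction w)
  case (Cons a w)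
  let ?s = "replicate (count_list w True) True"
  let ?r = "replicate (length w - count_list w True) False"
  have "((tm_morph ^^ k) [a] @ (tm_morph ^^ k) w, (tm_morph ^^ k) [a] @ (tm_morph ^^ k) (?s @ ?r))
      \<in> binom_equiv (Suc k)"
    by (intro binom_equiv_append Cons.IH binom_equiv_refl)
  then have *: "((tm_morph ^^ k) (a # w), (tm_morph ^^ k) (a # ?s @ ?r)) \<in> binom_equiv (Suc k)"
    by (simp flip: funpow_tm_morph_append)
  show ?case
  proof (cases a)
    case True
    then show ?thesis using * by simp
  next
    case False
    have "count_list w True \<le> length w" by (rule count_le_length)
    then have "False # ?r = replicate (Suc (length w) - count_list w True) False"
      by (simp add: Suc_diff_le)
    then show ?thesis
      using False binom_equiv_trans[OF * funpow_tm_morph_swap] by simp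
  qed
qed simp

lemma funpow_tm_morph_abelian_equiv:
  assumes "length w = length w'" "count_list w True = count_list w' True"
  shows "((tm_morph ^^ k) w, (tm_morph ^^ k) w') \<in> binom_equiv (Suc k)"
  using binom_equiv_trans[OF funpow_tm_morph_sort_equiv[of k w]
      binom_equiv_sym[OF funpow_tm_morph_sort_equiv[of k w', folded assms]]] .

section \<open>Block decomposition of factors of infinite images\<close>

lemma prefix_funpow_tm_morph_inf:
  "prefix (2 ^ k * n) ((tm_morph_inf ^^ k) z) = (tm_morph ^^ k) (prefix n z)"
  by (induction k) (simp_all add: prefix_tm_morph_inf mult.assoc)

lemma subsequence_append_adjacent:
  "i \<le> j \<Longrightarrow> j \<le> l \<Longrightarrow> subsequence z i l = subsequence z i j @ subsequence z j l"
  by (metis le_add_diff_inverse le_trans map_append subsequence_def upt_add_eq_append)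

lemma subsequence_funpow_tm_morph_inf:
  assumes "q \<le> q'"
  shows "subsequence ((tm_morph_inf ^^ k) z) (2 ^ k * q) (2 ^ k * q') = (tm_morph ^^ k) (subsequence z q q')"
proof -
  have "prefix (2 ^ k * q') ((tm_morph_inf ^^ k) z) = (tm_morph ^^ k) (prefix q z @ subsequence z q q')"
    using assms by (simp add: prefix_funpow_tm_morph_inf flip: subsequence_append_adjacent)
  moreover have "prefix (2 ^ k * q') ((tm_morph_inf ^^ k) z) =
      prefix (2 ^ k * q) ((tm_morph_inf ^^ k) z) @ subsequence ((tm_morph_inf ^^ k) z) (2 ^ k * q) (2 ^ k * q')"
    using assms by (simp flip: subsequence_append_adjacent)
  ultimately show ?thesis
    by (simp add: funpow_tm_morph_append prefix_funpow_tm_morph_inf)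
qed

lemma subsequence_eq_take_drop:
  "i + r + n \<le> j \<Longrightarrow> subsequence z (i + r) (i + r + n) = take n (drop r (subsequence z i j))"
  by (simp add: subsequence_def take_map drop_map drop_upt take_upt)

text \<open>When \<open>r + n\<close> is less than the block length, \<open>m = 0\<close> and the letter \<open>z (q + m + 1)\<close> plays
  no role.\<close>

lemma factor_funpow_tm_morph_inf_equiv:
  fixes k q q' r n :: nat
  defines "m \<equiv> (r + n) div 2 ^ k - 1"
  assumes r: "r < 2 ^ k"
    and first: "z q = z' q'" and last: "z (q + m + 1) = z' (q' + m + 1)"
    and count: "count_list (subsequence z (q + 1) (q + m + 1)) True =
      count_list (subsequence z' (q' + 1) (q' + m + 1)) True"
  shows "(subsequence ((tm_morph_inf ^^ k) z) (2 ^ k * q + r) (2 ^ k * q + r + n),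
    subsequence ((tm_morph_inf ^^ k) z') (2 ^ k * q' + r) (2 ^ k * q' + r + n)) \<in> binom_equiv (Suc k)"
proof -
  define A where "A = (tm_morph ^^ k) [z q]"
  define B where "B = (tm_morph ^^ k) [z (q + m + 1)]"
  define W where "W = (tm_morph ^^ k) (subsequence z (q + 1) (q + m + 1))"
  define W' where "W' = (tm_morph ^^ k) (subsequence z' (q' + 1) (q' + m + 1))"
  \<comment> \<open>Truncated subtraction can only enlarge \<open>m\<close>, so \<open>m + 2\<close>
    blocks always contain the factor.\<close>
  have bound: "r + n \<le> 2 ^ k * (m + 2)"
  proof -
    have "r + n < 2 ^ k * ((r + n) div 2 ^ k) + 2 ^ k"
      using mod_less_divisor[of "2 ^ k" "r + n"] by (metis add.commute add_less_cancel_right mod_mult_div_eq pos2 zero_less_power)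
    also have "\<dots> = 2 ^ k * ((r + n) div 2 ^ k + 1)" by simp
    also have "\<dots> \<le> 2 ^ k * (m + 2)" unfolding m_def by (intro mult_le_mono2) linarith
    finally show ?thesis by simp
  qed
  have eq: "subsequence ((tm_morph_inf ^^ k) s) (2 ^ k * p + r) (2 ^ k * p + r + n) =
      take n (drop r ((tm_morph ^^ k) [s p] @ (tm_morph ^^ k) (subsequence s (p + 1) (p + m + 1)) @
        (tm_morph ^^ k) [s (p + m + 1)]))" for s p
  proof -
    have "2 ^ k * p + r + n \<le> 2 ^ k * (p + m + 2)"
      using bound by (simp add: algebra_simps)
    then have "subsequence ((tm_morph_inf ^^ k) s) (2 ^ k * p + r) (2 ^ k * p + r + n) =
        take n (drop r ((tm_morph ^^ k) (subsequence s p (p + m + 2))))"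
      unfolding subsequence_funpow_tm_morph_inf[OF trans_le_add1[OF le_add1], symmetric]
      by (rule subsequence_eq_take_drop)
    moreover have "subsequence s p (p + m + 2) = [s p] @ subsequence s (p + 1) (p + m + 1) @ [s (p + m + 1)]"
      using subsequence_append_adjacent[of p "p + 1" "p + m + 2" s]
        subsequence_append_adjacent[of "p + 1" "p + m + 1" "p + m + 2" s]
      by (simp add: subsequence_def)
    ultimately show ?thesis by (simp only: funpow_tm_morph_append)
  qed
  have lens: "length A = 2 ^ k" "length W = 2 ^ k * m" "length W' = 2 ^ k * m"
    by (simp_all add: A_def W_def W'_def)
  have WW': "(W, W') \<in> binom_equiv (Suc k)"
    unfolding W_def W'_def by (rule funpow_tm_morph_abelian_equiv) (use count in simp_all)
  have "(take n (drop r (A @ W @ B)), take n (drop r (A @ W' @ B))) \<in> binom_equiv (Suc k)"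
  proof (cases "m = 0")
    case True
    then show ?thesis using lens by simp
  next
    case False
    \<comment> \<open>For \<open>m > 0\<close> the subtraction is exact, so the factor contains the
      rest of the first block and the whole middle part.\<close>
    then have "2 ^ k * (m + 1) \<le> r + n"
      unfolding m_def by (metis One_nat_def Suc_eq_plus1 Suc_pred bot_nat_0.not_eq_extremum diff_0_eq_0 mult.commute times_div_less_eq_dividend)
    then have "take n (drop r (A @ V @ B)) = drop r A @ V @ take (n - (2 ^ k - r) - 2 ^ k * m) B"
      if "length V = 2 ^ k * m" for V
      using r that lens(1) by simp
    then show ?thesis
      using lens WW' by (simp add: binom_equiv_append)
  qed
  then show ?thesis
    unfolding eq using first last by (simp add: A_def B_def W_def W'_def)
qed

subsection \<open>Letter patterns in aperiodic words\<close>

text \<open>Within each residue class modulo \<open>p\<close> there is at most one ascent.\<close>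

lemma ultimately_periodic_if_mono:
  fixes y :: "bool word"
  assumes "p > 0" and mono: "\<And>n. n \<ge> N \<Longrightarrow> y n \<Longrightarrow> y (n + p)"
  shows "ultimately_periodic y"
proof -
  define D where "D = {n. n \<ge> N \<and> \<not> y n \<and> y (n + p)}"
  have up: "y (n + i * p)" if "n \<ge> N" "y n" for n i
  proof (induction i)
    case (Suc i)
    then show ?case using mono[of "n + i * p"] that by (simp add: algebra_simps)
  qed (use that in simp)
  have "inj_on (\<lambda>n. n mod p) D"
  proof (rule linorder_inj_onI')
    fix a b assume ab: "a \<in> D" "b \<in> D" "a < b"
    show "a mod p \<noteq> b mod p"
    proof
      assume "a mod p = b mod p"
      then have "p dvd b - a" using ab(3) by (metis less_imp_le mod_eq_dvd_iff_nat)
      then obtain c where "b - a = p * c" ..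
      then have c: "b = a + c * p" using ab(3) by (simp add: mult.commute)
      then obtain i where "c = Suc i" using ab(3) by (cases c) auto
      then have "y b" using up[of "a + p" i] ab c by (simp add: D_def algebra_simps)
      then show False using ab by (simp add: D_def)
    qed
  qed
  moreover have "finite ((\<lambda>n. n mod p) ` D)"
    by (rule finite_subset[of _ "{..<p}"]) (use \<open>p > 0\<close> in auto)
  ultimately have "finite D" by (rule finite_imageD[rotated])
  then obtain M where "\<forall>n\<in>D. n \<le> M" using finite_nat_set_iff_bounded_le by blast
  then have "\<forall>n\<ge>max N (Suc M). y (n + p) = y n"
    using mono by (fastforce simp: D_def)
  then show ?thesis unfolding ultimately_periodic_def using \<open>p > 0\<close> by blast
qed

text \<open>Otherwise \<open>y\<close> or its complement would eventually be monotone along steps of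
  \<open>p\<close>.\<close>

lemma aperiodic_change:
  assumes "aperiodic y" "p > 0"
  shows "\<exists>n\<ge>N. y n = a \<and> y (n + p) = (\<not> a)"
proof (rule ccontr)
  assume no: "\<not> ?thesis"
  have "ultimately_periodic (\<lambda>n. y n = a)"
    by (rule ultimately_periodic_if_mono[OF \<open>p > 0\<close>, of N]) (use no in auto)
  then have "ultimately_periodic y" by (auto simp: ultimately_periodic_def)
  then show False using assms(1) by (simp add: aperiodic_def)
qed

text \<open>Permanent disagreement at distance \<open>p\<close> would give the period
  \<open>2 * p\<close>.\<close>

lemma aperiodic_repeat:
  assumes "aperiodic (y :: bool word)" "p > 0"
  shows "\<exists>n\<ge>N. y n = y (n + p)"
proof (rule ccontr)
  assume no: "\<not> ?thesis"
  then have "y (n + p + p) = y n" if "n \<ge> N" for n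
    using that by (metis le_add1 le_trans)
  then have "\<forall>n\<ge>N. y (n + (p + p)) = y n" by (simp add: add.assoc)
  then have "ultimately_periodic y" unfolding ultimately_periodic_def
    using \<open>p > 0\<close> by (metis add_gr_0)
  then show False using assms(1) by (simp add: aperiodic_def)
qed

lemma aperiodic_repeat_alternative:
  assumes "aperiodic y"
  shows "\<exists>n\<ge>N. (y n = a \<and> y (n + d) = a) \<or> (y n = (\<not> a) \<and> y (n + Suc d) = (\<not> a))"
proof (rule ccontr)
  assume no: "\<not> ?thesis"
  \<comment> \<open>The letter at \<open>n + d\<close> lies \<open>d\<close> after one end of this
    change and \<open>Suc d\<close> before the other, so it agrees with one of them.\<close>
  obtain n where n: "n \<ge> N" "y n = a" "y (n + (d + Suc d)) = (\<not> a)"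
    using aperiodic_change[OF assms, of "d + Suc d" N a] by auto
  then have "y (n + d) = (\<not> a)" using no by blast
  moreover have "n + d \<ge> N" using n by simp
  ultimately have "y (n + d + Suc d) = a" using no by blast
  then show False using n(3) by (simp add: add.assoc)
qed

section \<open>Letter counts and patterns in images under the morphism\<close>

lemma count_list_tm_morph: "count_list (tm_morph w) True = length w"
proof (induction w)
  case (Cons a w)
  then show ?case by (cases a) (simp_all add: tm_morph_def)
qed (simp add: tm_morph_def)

lemma count_prefix_tm_morph_inf_even: "count_list (prefix (2 * h) (tm_morph_inf y)) True = h"
  by (simp add: prefix_tm_morph_inf count_list_tm_morph)

lemma count_prefix_tm_morph_inf_odd:
  "count_list (prefix (Suc (2 * h)) (tm_morph_inf y)) True = h + of_bool (y h)"
  using count_prefix_tm_morph_inf_even[of y h]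
  by (simp add: subsequence_append_adjacent[of 0 "2 * h" "Suc (2 * h)"])

lemma count_subsequence:
  "i \<le> j \<Longrightarrow> int (count_list (subsequence z i j) a) =
    int (count_list (prefix j z) a) - int (count_list (prefix i z) a)"
  by (simp add: subsequence_append_adjacent[of 0 i j])

text \<open>With \<open>e = m + 1\<close>, the data compared in
  \<open>factor_funpow_tm_morph_inf_equiv\<close>. An integer count allows untruncated differences
  of prefix counts.\<close>

definition pattern :: "bool word \<Rightarrow> nat \<Rightarrow> nat \<Rightarrow> bool \<times> bool \<times> int" where
  "pattern z e q = (z q, z (q + e), int (count_list (subsequence z (q + 1) (q + e)) True))"

text \<open>In all four parity cases, complete letter images between the ends contribute one
  \<open>True\<close> each; only halves of images left over at the ends depend on
  \<open>y\<close>.\<close>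

lemma pattern_even_even:
  assumes "d > 0"
  shows "pattern (tm_morph_inf y) (2 * d) (2 * h) = (y h, y (h + d), int d - of_bool (y h))"
proof -
  have "2 * h + 2 * d = 2 * (h + d)" by simp
  then show ?thesis using assms
    by (simp add: pattern_def count_subsequence count_prefix_tm_morph_inf_even
        count_prefix_tm_morph_inf_odd del: add_mult_distrib2 distrib_left_numeral)
qed

lemma pattern_even_odd:
  assumes "d > 0"
  shows "pattern (tm_morph_inf y) (2 * d) (Suc (2 * h)) =
    (\<not> y h, \<not> y (h + d), int d - 1 + of_bool (y (h + d)))"
proof -
  have "Suc (2 * h) + 2 * d = Suc (2 * (h + d))" "Suc (Suc (2 * h)) = 2 * Suc h" by simp_all
  then show ?thesis using assms
    by (simp add: pattern_def count_subsequence count_prefix_tm_morph_inf_even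
        count_prefix_tm_morph_inf_odd del: add_mult_distrib2 distrib_left_numeral mult_Suc_right)
qed

text \<open>For \<open>d = 0\<close> nothing lies between the ends, and the two corrections
  cancel.\<close>

lemma pattern_odd_even:
  "pattern (tm_morph_inf y) (Suc (2 * d)) (2 * h) =
    (y h, \<not> y (h + d), int d + of_bool (y (h + d)) - of_bool (y h))"
proof -
  have "2 * h + Suc (2 * d) = Suc (2 * (h + d))" by simp
  then show ?thesis
    by (simp add: pattern_def count_subsequence count_prefix_tm_morph_inf_even
        count_prefix_tm_morph_inf_odd del: add_mult_distrib2 distrib_left_numeral)
qed

lemma pattern_odd_odd:
  "pattern (tm_morph_inf y) (Suc (2 * d)) (Suc (2 * h)) = (\<not> y h, y (h + Suc d), int d)"
proof -
  have "Suc (2 * h) + Suc (2 * d) = 2 * (h + Suc d)" "Suc (Suc (2 * h)) = 2 * Suc h" by simp_all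
  then show ?thesis
    by (simp add: pattern_def count_subsequence count_prefix_tm_morph_inf_even
        count_prefix_tm_morph_inf_odd del: add_mult_distrib2 distrib_left_numeral mult_Suc_right)
qed

text \<open>Parities of \<open>e\<close> and \<open>q\<close> leave a short list of possible
  patterns; each is produced arbitrarily far out by a suitable change or repetition of letters in
  \<open>y'\<close>.\<close>

lemma pattern_recurs:
  assumes y': "aperiodic y'" and "e > 0"
  shows "\<exists>q'\<ge>N. pattern (tm_morph_inf y') e q' = pattern (tm_morph_inf y) e q"
proof -
  let ?T = "\<lambda>t. \<exists>q'\<ge>N. pattern (tm_morph_inf y') e q' = t"
  have even_pos: "?T (pattern (tm_morph_inf y') e (2 * h))" if "h \<ge> N" for h
    using that by (intro exI[of _ "2 * h"]) simp
  have odd_pos: "?T (pattern (tm_morph_inf y') e (Suc (2 * h)))" if "h \<ge> N" for h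
    using that by (intro exI[of _ "Suc (2 * h)"]) simp
  obtain h where h: "q = 2 * h \<or> q = Suc (2 * h)" by (metis evenE oddE Suc_eq_plus1)
  show ?thesis
  proof (cases "even e")
    case True
    then obtain d where e: "e = 2 * d" and d: "d > 0" using \<open>e > 0\<close> by (auto elim!: evenE)
    note pat = pattern_even_even[OF d] pattern_even_odd[OF d]
    obtain f1 where f1: "f1 \<ge> N" "y' f1" "\<not> y' (f1 + d)"
      using aperiodic_change[OF y' d, of N True] by auto
    obtain f0 where f0: "f0 \<ge> N" "\<not> y' f0" "y' (f0 + d)"
      using aperiodic_change[OF y' d, of N False] by auto
    obtain g where g: "g \<ge> N" "y' g = y' (g + d)"
      using aperiodic_repeat[OF y' d, of N] by auto
    \<comment> \<open>One repetition of either letter yields both triples with equal ends: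
      complementing the letter just exchanges the even and odd positions.\<close>
    have "?T (True, False, int d - 1)" "?T (False, True, int d - 1)"
      "?T (False, True, int d)" "?T (True, False, int d)"
      "?T (False, False, int d)" "?T (True, True, int d - 1)"
      using even_pos[OF f1(1)] odd_pos[OF f1(1)] even_pos[OF f0(1)] odd_pos[OF f0(1)]
        even_pos[OF g(1)] odd_pos[OF g(1)] f1 f0 g
      by (cases "y' g"; simp add: e pat)+
    then show ?thesis
      using h by (cases "y h"; cases "y (h + d)") (auto simp: e pat)
  next
    case False
    then obtain d where e: "e = Suc (2 * d)" by (auto elim!: oddE)
    note pat = pattern_odd_even pattern_odd_odd
    have ends: "?T (a, a, int d)" for a
    proof -
      obtain h where "h \<ge> N" "y' h = (\<not> a)" "y' (h + Suc d) = a"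
        using aperiodic_change[OF y', of "Suc d" N "\<not> a"] by auto
      then show ?thesis using odd_pos[of h] by (simp add: e pat)
    qed
    \<comment> \<open>Two sources suffice: letter \<open>a\<close> repeated at distance
      \<open>d\<close>, read from an even position, or its negation repeated at distance
      \<open>Suc d\<close>, read from an odd one.\<close>
    have mixed: "?T (a, \<not> a, int d)" for a
    proof -
      obtain g where "g \<ge> N" "(y' g = a \<and> y' (g + d) = a) \<or> (y' g = (\<not> a) \<and> y' (g + Suc d) = (\<not> a))"
        using aperiodic_repeat_alternative[OF y'] by blast
      then show ?thesis using even_pos[of g] odd_pos[of g] by (auto simp: e pat)
    qed
    have unbal: "?T (a, a, int d + of_bool (\<not> a) - of_bool a)" if "d > 0" for a
    proof -
      obtain h where "h \<ge> N" "y' h = a" "y' (h + d) = (\<not> a)"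
        using aperiodic_change[OF y' \<open>d > 0\<close>, of N a] by auto
      then show ?thesis using even_pos[of h] by (simp add: e pat)
    qed
    from h show ?thesis
    proof
      assume q: "q = 2 * h"
      show ?thesis
      proof (cases "y (h + d) = y h")
        case True
        then show ?thesis using mixed[of "y h"] by (simp add: q e pat)
      next
        case False
        then have "d > 0" by (cases d) auto
        then show ?thesis using unbal[of "y h"] False by (simp add: q e pat)
      qed
    next
      assume q: "q = Suc (2 * h)"
      show ?thesis
        using mixed[of "\<not> y h"] ends[of "\<not> y h"]
        by (cases "y (h + Suc d) = y h") (simp_all add: q e pat)
    qed
  qed
qed

subsection \<open>Aperiodicity and comparison of complexities\<close>

text \<open>A period \<open>p\<close> of the image, used twice from an even position, becomes a
  period \<open>p\<close> of \<open>y\<close>.\<close>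

lemma aperiodic_tm_morph_inf:
  assumes "aperiodic y"
  shows "aperiodic (tm_morph_inf y)"
  unfolding aperiodic_def
proof
  assume "ultimately_periodic (tm_morph_inf y)"
  then obtain p N where p: "p > 0" and per: "\<And>n. n \<ge> N \<Longrightarrow> tm_morph_inf y (n + p) = tm_morph_inf y n"
    by (auto simp: ultimately_periodic_def)
  have "y (n + p) = y n" if "n \<ge> N" for n
  proof -
    have "y (n + p) = tm_morph_inf y (2 * n + p + p)"
      using tm_morph_inf_even[of y "n + p"] by (simp add: algebra_simps mult_2)
    also have "\<dots> = y n" using per[of "2 * n + p"] per[of "2 * n"] that by simp
    finally show ?thesis .
  qed
  then have "ultimately_periodic y" unfolding ultimately_periodic_def using p by blast
  then show False using assms by (simp add: aperiodic_def)
qed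

lemma aperiodic_funpow_tm_morph_inf: "aperiodic y \<Longrightarrow> aperiodic ((tm_morph_inf ^^ k) y)"
  by (induction k) (simp_all add: aperiodic_tm_morph_inf)

text \<open>An even period can be halved; an odd period forces the word to alternate, which is
  incompatible with being a fixed point.\<close>

lemma aperiodic_if_fixed:
  assumes fixed: "tm_morph_inf y = y"
  shows "aperiodic y"
proof -
  have even: "y (2 * n) = y n" and odd: "y (Suc (2 * n)) = (\<not> y n)" for n
    using tm_morph_inf_even[of y n] tm_morph_inf_odd[of y n] by (simp_all add: fixed)
  have "\<not> (\<forall>n\<ge>N. y (n + p) = y n)" if "p > 0" for p N
    using that
  proof (induction p rule: less_induct)
    case (less p)
    show ?case
    proof
      assume per: "\<forall>n\<ge>N. y (n + p) = y n"
      show False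
      proof (cases "even p")
        case True
        then obtain r where r: "p = 2 * r" by blast
        have "y (n + r) = y n" if "n \<ge> N" for n
          using per[rule_format, of "2 * n"] even[of "n + r"] even[of n] that r by simp
        then show False using less.IH[of r] less.prems r by auto
      next
        case False
        then obtain r where r: "p = Suc (2 * r)" by (auto elim!: oddE)
        have alt: "y (Suc (2 * n)) = (\<not> y (2 * Suc n))" if "n \<ge> N" for n
        proof -
          have "y (Suc (2 * n)) = y (2 * (n + Suc r))"
            using per[rule_format, of "Suc (2 * n)"] that r by (simp add: algebra_simps)
          moreover have "y (2 * Suc n) = y (Suc (2 * (n + Suc r)))"
            using per[rule_format, of "2 * Suc n"] that r by (simp add: algebra_simps)
          ultimately show ?thesis using even odd by blast
        qed
        have const: "y (Suc n) = y n" if "n \<ge> N" for n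
          using alt[OF that] even[of "Suc n"] odd[of n] by blast
        show False
          using const[of "2 * N"] even[of N] odd[of N] by simp
      qed
    qed
  qed
  then show ?thesis by (auto simp: aperiodic_def ultimately_periodic_def)
qed

text \<open>The innermost application of the morphism supplies the patterns, the other
  \<open>k\<close> the blocks. Keeping the offset \<open>r\<close> and taking \<open>q'\<close>
  large places the match beyond \<open>M'\<close>.\<close>

lemma factors_recur_up_to_binom_equiv:
  assumes y': "aperiodic y'" and u: "u \<in> factors n (suffix M ((tm_morph_inf ^^ Suc k) y))"
  shows "\<exists>v\<in>factors n (suffix M' ((tm_morph_inf ^^ Suc k) y')). (u, v) \<in> binom_equiv (Suc k)"
proof -
  let ?X = "\<lambda>y. (tm_morph_inf ^^ k) (tm_morph_inf y)"
  have X: "(tm_morph_inf ^^ Suc k) y = ?X y" for y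
    by (simp add: funpow_Suc_right del: funpow.simps)
  obtain i where u_eq: "u = subsequence (?X y) i (i + n)"
    using u unfolding X by (auto simp: factors_def simp flip: add.assoc)
  define q where "q = i div 2 ^ k"
  define r where "r = i mod 2 ^ k"
  define m where "m = (r + n) div 2 ^ k - 1"
  have i: "i = 2 ^ k * q + r" and r: "r < 2 ^ k" by (simp_all add: q_def r_def)
  obtain q' where q': "q' \<ge> M'"
    and pat: "pattern (tm_morph_inf y') (m + 1) q' = pattern (tm_morph_inf y) (m + 1) q"
    using pattern_recurs[OF y', of "m + 1" M' y q] by auto
  let ?i' = "2 ^ k * q' + r"
  have "M' \<le> 2 ^ k * q'"
    by (rule le_trans[OF q']) simp
  then have "subsequence (?X y') ?i' (?i' + n) \<in> factors n (suffix M' (?X y'))"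
    unfolding factors_def
    by (auto intro!: exI[of _ "?i' - M'"])
  moreover have "(u, subsequence (?X y') ?i' (?i' + n)) \<in> binom_equiv (Suc k)"
    unfolding u_eq i using pat
    by (intro factor_funpow_tm_morph_inf_equiv[OF r]) (auto simp: pattern_def m_def add.assoc)
  ultimately show ?thesis unfolding X by blast
qed

lemma quotient_subset_if_equiv:
  assumes "equiv UNIV R" "\<And>u. u \<in> A \<Longrightarrow> \<exists>v\<in>B. (u, v) \<in> R"
  shows "A // R \<subseteq> B // R"
proof
  fix C assume "C \<in> A // R"
  then obtain u where u: "u \<in> A" "C = R `` {u}" by (auto elim: quotientE)
  with assms(2) obtain v where "v \<in> B" "(u, v) \<in> R" by blast
  with assms(1) u show "C \<in> B // R" by (metis equiv_class_eq quotientI)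
qed

lemma binom_complexity_funpow_tm_morph_inf:
  assumes "aperiodic y" "aperiodic y'"
  shows "binom_complexity (Suc k) (suffix M ((tm_morph_inf ^^ Suc k) y)) =
    binom_complexity (Suc k) (suffix M' ((tm_morph_inf ^^ Suc k) y'))"
proof
  fix n
  show "binom_complexity (Suc k) (suffix M ((tm_morph_inf ^^ Suc k) y)) n =
    binom_complexity (Suc k) (suffix M' ((tm_morph_inf ^^ Suc k) y')) n"
    unfolding binom_complexity_def
    by (intro arg_cong[where f = card] equalityI quotient_subset_if_equiv[OF equiv_binom_equiv]
        factors_recur_up_to_binom_equiv assms)
qed

theorem theorem4p2:
  fixes k :: nat and x y :: "bool word"
  assumes "aperiodic y"
    and "x = (tm_morph_inf ^^ k) y"
  shows "TM k x \<and> (\<forall>m. TM k (suffix m x))"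
proof -
  have "binom_complexity j (suffix m x) = binom_complexity j thue_morse"
    if j: "1 \<le> j" "j \<le> k" for j m
  proof -
    obtain i where i: "j = Suc i" using j by (cases j) auto
    \<comment> \<open>The surplus \<open>k - j\<close> applications go into the aperiodic argument,
      leaving exactly \<open>j\<close> outer ones.\<close>
    let ?z = "(tm_morph_inf ^^ (k - j)) y"
    have x: "x = (tm_morph_inf ^^ j) ?z"
      using assms(2) j funpow_add[of j "k - j" tm_morph_inf] by simp
    \<comment> \<open>As a fixed point, \<open>thue_morse\<close> is its own \<open>j\<close>-th
      image, so the comparison applies to it with shift 0.\<close>
    have t: "suffix 0 ((tm_morph_inf ^^ j) thue_morse) = thue_morse"
      by (induction j) (simp_all add: thue_morse_fixed)
    show ?thesis
      using binom_complexity_funpow_tm_morph_inf[OF aperiodic_funpow_tm_morph_inf[OF assms(1)]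
          aperiodic_if_fixed[OF thue_morse_fixed], of i m "k - j" 0]
      unfolding i[symmetric] x[symmetric] t .
  qed
  then have "TM k (suffix m x)" for m by (simp add: TM_def)
  from this this[of 0] show ?thesis by simp
qed

end
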